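(* If the uncertainty set $\Xi$ is convex and closed, the loss function is additively separable with respect to $\bm{\xi}$, i.e. $\ell(\bm{x},\bm{\xi})=\sum_{k=1}^K\max_{j\in[J]}\ell_{jk}(\xi_k)$, and $\{-\ell_{jk}\}_{j\in[J]}$ is proper, convex, and lower semicontinuous for all $k\in[K]$, then the distributionally robust problem $$\inf_{\bm{x}\in\mathbb{X}}\left\{\sup_{\mathbb{P}\in\mathcal{P}}\ \mathbb{E}_{\bm{\xi}\sim\mathbb{P}}[\ell(\bm{x},\bm{\xi})]\right\}$$ is equivalent to the problem $$\begin{aligned}\inf_{\bm{x},\lambda,s_{ik},\gamma_{ijk}}\quad & \lambda\epsilon+\frac1N\sum_{i=1}^N\sum_{k=1}^K s_{ik}\\ \text{s.t.}\quad & \bm{x}\in\mathbb{X},\\ & b_{jk}+\langle a_{jk},\hat\xi_{ik}\rangle+\langle\gamma_{ijk},d_k-C_k\hat\xi_{ik}\rangle\le s_{ik},\quad \forall i\in[N],\,j\in[J],\,k\in[K],\\ & \|C_k^{\mathsf T}\gamma_{ijk}-a_{jk}\|_*\le\lambda,\quad \forall i\in[N],\,j\in[J],\,k\in[K],\\ & \gamma_{ijk}\ge 0,\quad \forall i\in[N],\,j\in[J],\,k\in[K].\end{aligned}$$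
   Context: For a positive integer $n$, $[n]=\{1,\dots,n\}$. There are $K$ regions; $x_k\ge 0$ is the amount of resource allocated to region $k$, $B>0$ is the total resource budget, and $\mathbb{X}=\{\bm{x}\in\mathbb{R}^K_+:\sum_{k=1}^K x_k\le B\}$. The uncertain demand is the random vector $\bm{\xi}=(\xi_1,\dots,\xi_K)^{\mathsf T}$. The uncertainty set (support) $\Xi$ is the Cartesian product of closed convex sets $\Xi_k$, with $\xi_k\in\Xi_k$ for $k\in[K]$. The loss in the resource allocation model is $\ell(\bm{x},\bm{\xi})=(\bm{c}^u)^{\mathsf T}(\bm{\xi}-\bm{x})^+ +(\bm{c}^o)^{\mathsf T}(\bm{x}-\bm{\xi})^+$, where $\bm{c}^u,\bm{c}^o$ are the vectors of unit penalty costs of unmet and over-served demand and $(\cdot)^+$ is the componentwise positive part. For given $\bm{x}$ it is written as $\sum_{k=1}^K\max_{j\in[J]}\ell_{jk}(\xi_k)$, where $J$ is the number of elementary functions and each $\ell_{jk}:\mathbb{R}\to\overline{\mathbb{R}}$ is measurable. $\|\cdot\|$ is the $L_1$-norm, $\|\cdot\|_*$ its dual norm, and $\langle\cdot,\cdot\rangle$ the inner product. $\mathcal{M}(\Xi)$ is the set of all probability distributions $\mathbb{P}$ supported on $\Xi$ with $\int_\Xi\|\bm{\xi}\|\,\mathbb{P}(d\bm{\xi})<\infty$. The Wasserstein metric $d_W:\mathcal{M}(\Xi)\times\mathcal{M}(\Xi)\to\mathbb{R}_+$ is $d_W(\mathbb{P},\hat{\mathbb{P}}_N)=\inf_\Pi\int_{\Xi^2}\|\bm{\xi}-\hat{\bm{\xi}}\|\,\Pi(d\bm{\xi},d\hat{\bm{\xi}})$,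 the infimum being over joint distributions $\Pi$ of $\bm{\xi}$ and $\hat{\bm{\xi}}$ with marginals $\mathbb{P}$ and $\hat{\mathbb{P}}_N$. Here $\hat{\mathbb{P}}_N\in\mathcal{M}(\Xi)$ is the empirical distribution of $N$ samples $\hat{\bm{\xi}}_i=(\hat\xi_{i1},\dots,\hat\xi_{iK})^{\mathsf T}$, $i\in[N]$. The ambiguity set is the Wasserstein ball $\mathcal{P}=\{\mathbb{P}\in\mathcal{M}(\Xi):d_W(\mathbb{P},\hat{\mathbb{P}}_N)\le\epsilon\}$ of radius $\epsilon$. Symbols in the second problem: $a_{jk},b_{jk}$ denote the coefficients in the representation $\ell_{jk}(\xi_k)=\langle a_{jk},\xi_k\rangle+b_{jk}$ of the loss pieces, and $C_k,d_k$ the data in the representation $\Xi_k=\{\xi_k: C_k\xi_k\le d_k\}$ of the support. The variables $\lambda$ and $s_{ik}$ are scalars, and $\gamma_{ijk}$ is a vector of the same dimension as $d_k$. *)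

theory Defs
  imports "HOL-Probability.Probability"
begin

definition l1_norm :: "'a::euclidean_space \<Rightarrow> real" where
  "l1_norm v = (\<Sum>b\<in>Basis. \<bar>v \<bullet> b\<bar>)"

definition dual_norm :: "('a::real_inner \<Rightarrow> real) \<Rightarrow> 'a \<Rightarrow> real" where
  "dual_norm nrm z = (SUP v\<in>{v. nrm v \<le> 1}. z \<bullet> v)"

definition proper_fun :: "('a \<Rightarrow> ereal) \<Rightarrow> bool" where
  "proper_fun f \<longleftrightarrow> (\<forall>t. f t \<noteq> -\<infinity>) \<and> (\<exists>t. f t \<noteq> \<infinity>)"

text \<open>Convexity is convexity of the epigraph, which avoids sums of the form \<open>\<infinity> - \<infinity>\<close>.\<close>

definition convex_fun :: "('a::real_vector \<Rightarrow> ereal) \<Rightarrow> bool" where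
  "convex_fun f \<longleftrightarrow> convex {(t, r::real). f t \<le> ereal r}"

definition lsc_fun :: "('a::topological_space \<Rightarrow> ereal) \<Rightarrow> bool" where
  "lsc_fun f \<longleftrightarrow> (\<forall>t. f t \<le> Liminf (at t) f)"

definition prob_dists :: "(real ^ 'k) set \<Rightarrow> (real ^ 'k) measure set" where
  "prob_dists \<Xi> = {P. sets P = sets borel \<and> prob_space P \<and> (AE \<xi> in P. \<xi> \<in> \<Xi>) \<and> integrable P l1_norm}"

definition couplings ::
  "(real ^ 'k) measure \<Rightarrow> (real ^ 'k) measure \<Rightarrow> ((real ^ 'k) \<times> (real ^ 'k)) measure set" where
  "couplings P Q = {\<pi>. sets \<pi> = sets (borel \<Otimes>\<^sub>M borel) \<and> prob_space \<pi> \<and>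
     distr \<pi> borel fst = P \<and> distr \<pi> borel snd = Q}"

definition wasserstein :: "(real ^ 'k) measure \<Rightarrow> (real ^ 'k) measure \<Rightarrow> ennreal" where
  "wasserstein P Q = (INF \<pi>\<in>couplings P Q. \<integral>\<^sup>+(\<xi>, \<zeta>). ennreal (l1_norm (\<xi> - \<zeta>)) \<partial>\<pi>)"

definition empirical :: "nat \<Rightarrow> (nat \<Rightarrow> real ^ 'k) \<Rightarrow> (real ^ 'k) measure" where
  "empirical N \<xi>h = distr (uniform_count_measure {1..N}) borel \<xi>h"

definition wasserstein_ball ::
  "(real ^ 'k) set \<Rightarrow> (real ^ 'k) measure \<Rightarrow> real \<Rightarrow> (real ^ 'k) measure set" where
  "wasserstein_ball \<Xi> Q \<epsilon> = {P \<in> prob_dists \<Xi>. wasserstein P Q \<le> ennreal \<epsilon>}"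

definition budget_set :: "real \<Rightarrow> (real ^ 'k) set" where
  "budget_set B = {x. (\<forall>k. 0 \<le> x $ k) \<and> (\<Sum>k\<in>UNIV. x $ k) \<le> B}"

text \<open>The expectation is an integral over \<open>\<Xi>\<close>, so the loss outside the support is irrelevant.\<close>

definition worst_case ::
  "((real ^ 'k) \<Rightarrow> (real ^ 'k) \<Rightarrow> real) \<Rightarrow> (real ^ 'k) set \<Rightarrow> (real ^ 'k) measure set \<Rightarrow> (real ^ 'k) \<Rightarrow> ereal" where
  "worst_case loss \<Xi> \<P> x = (SUP P\<in>\<P>. ereal (LINT \<xi>:\<Xi>|P. loss x \<xi>))"

text \<open>Each \<open>\<xi> $ k\<close> is a scalar, so \<open>C k\<close>, \<open>d k\<close> and \<open>\<gamma> i j k\<close> are vectors whose dimension \<open>m k\<close>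
  depends on \<open>k\<close>; they are represented by functions of which only the entries \<open>1..m k\<close> matter.
  The coefficients \<open>a x j k\<close> and \<open>b x j k\<close> belong to the loss at the decision \<open>x\<close>.\<close>

definition polyhedron1 :: "nat \<Rightarrow> (nat \<Rightarrow> real) \<Rightarrow> (nat \<Rightarrow> real) \<Rightarrow> real set" where
  "polyhedron1 n c e = {t. \<forall>r\<in>{1..n}. c r * t \<le> e r}"

definition dual_feasible ::
  "(real ^ 'k) set \<Rightarrow> nat \<Rightarrow> nat \<Rightarrow> (nat \<Rightarrow> real ^ 'k)
   \<Rightarrow> ((real ^ 'k) \<Rightarrow> nat \<Rightarrow> 'k \<Rightarrow> real) \<Rightarrow> ((real ^ 'k) \<Rightarrow> nat \<Rightarrow> 'k \<Rightarrow> real)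
   \<Rightarrow> ('k \<Rightarrow> nat) \<Rightarrow> ('k \<Rightarrow> nat \<Rightarrow> real) \<Rightarrow> ('k \<Rightarrow> nat \<Rightarrow> real)
   \<Rightarrow> ((real ^ 'k) \<times> real \<times> (nat \<Rightarrow> 'k \<Rightarrow> real) \<times> (nat \<Rightarrow> nat \<Rightarrow> 'k \<Rightarrow> nat \<Rightarrow> real)) set" where
  "dual_feasible X N J \<xi>h a b m C d = {(x, lam, s, \<gamma>). x \<in> X \<and>
     (\<forall>i\<in>{1..N}. \<forall>j\<in>{1..J}. \<forall>k.
        b x j k + a x j k * \<xi>h i $ k + (\<Sum>r=1..m k. \<gamma> i j k r * (d k r - C k r * \<xi>h i $ k)) \<le> s i k \<and>
        dual_norm l1_norm ((\<Sum>r=1..m k. C k r * \<gamma> i j k r) - a x j k) \<le> lam \<and>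
        (\<forall>r\<in>{1..m k}. 0 \<le> \<gamma> i j k r))}"

definition dual_objective ::
  "real \<Rightarrow> nat \<Rightarrow> ((real ^ 'k) \<times> real \<times> (nat \<Rightarrow> 'k \<Rightarrow> real) \<times> (nat \<Rightarrow> nat \<Rightarrow> 'k \<Rightarrow> nat \<Rightarrow> real)) \<Rightarrow> real" where
  "dual_objective \<epsilon> N = (\<lambda>(x, lam, s, \<gamma>). lam * \<epsilon> + 1 / real N * (\<Sum>i=1..N. \<Sum>k\<in>UNIV. s i k))"

definition is_minimizer :: "('a \<Rightarrow> ereal) \<Rightarrow> 'a set \<Rightarrow> 'a \<Rightarrow> bool" where
  "is_minimizer f S x \<longleftrightarrow> x \<in> S \<and> (\<forall>y\<in>S. f x \<le> f y)"

definition pos_part_vec :: "real ^ 'k \<Rightarrow> real ^ 'k" where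
  "pos_part_vec v = (\<chi> k. max (v $ k) 0)"

definition resource_loss :: "real ^ 'k \<Rightarrow> real ^ 'k \<Rightarrow> real ^ 'k \<Rightarrow> real ^ 'k \<Rightarrow> real" where
  "resource_loss cu co x \<xi> = cu \<bullet> pos_part_vec (\<xi> - x) + co \<bullet> pos_part_vec (x - \<xi>)"

text \<open>The resource allocation loss is an additively separable, piecewise affine loss with two
  pieces per region, whose intercepts depend on \<open>x\<close>.\<close>

lemma resource_loss_separable:
  fixes cu co x \<xi> :: "real ^ 'k"
  assumes "\<And>k. 0 \<le> cu $ k" and "\<And>k. 0 \<le> co $ k"
  defines "a \<equiv> \<lambda>(j::nat) k. if j = 1 then cu $ k else - co $ k"
    and "b \<equiv> \<lambda>(j::nat) k. if j = 1 then - cu $ k * x $ k else co $ k * x $ k"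
  shows "ereal (resource_loss cu co x \<xi>) =
    (\<Sum>k\<in>UNIV. Max ((\<lambda>j. ereal (a j k * \<xi> $ k + b j k)) ` {1..2}))"
proof -
  have S: "{1..2::nat} = {1, 2}" by auto
  have "cu $ k * max (\<xi> $ k - x $ k) 0 + co $ k * max (x $ k - \<xi> $ k) 0
      = max (a 1 k * \<xi> $ k + b 1 k) (a 2 k * \<xi> $ k + b 2 k)" for k
  proof (cases "x $ k \<le> \<xi> $ k")
    case True
    then have "0 \<le> cu $ k * (\<xi> $ k - x $ k)" "0 \<le> co $ k * (\<xi> $ k - x $ k)"
      using assms(1,2) by simp_all
    with True show ?thesis by (simp add: a_def b_def max_def algebra_simps)
  next
    case False
    then have "0 \<le> cu $ k * (x $ k - \<xi> $ k)" "0 \<le> co $ k * (x $ k - \<xi> $ k)"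
      using assms(1,2) by simp_all
    with False show ?thesis by (simp add: a_def b_def max_def algebra_simps)
  qed
  moreover have "Max ((\<lambda>j. ereal (a j k * \<xi> $ k + b j k)) ` {1..2})
      = ereal (max (a 1 k * \<xi> $ k + b 1 k) (a 2 k * \<xi> $ k + b 2 k))" for k
    unfolding S by (simp add: max_def)
  ultimately show ?thesis
    by (simp add: resource_loss_def pos_part_vec_def inner_vec_def sum.distrib [symmetric]
        ereal_max sum_ereal [symmetric] del: sum_ereal)
qed

end

theory Submission
  imports Defs
begin

text \<open>Fix a decision \<open>x\<close>. On the support the loss is \<open>f \<xi> = (\<Sum>k. Max\<^sub>j (a j k * \<xi> $ k + b j k))\<close>, and
  everything rests on a Lagrangian duality for the transport budget \<open>\<epsilon>\<close>, with multiplier \<open>\<lambda>\<close>.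

  Weak direction (\<open>wasserstein_weak_duality\<close>): if \<open>f \<xi> \<le> \<lambda> * \<parallel>\<xi> - \<xi>h i\<parallel> + \<sigma> i\<close> for all \<open>\<xi>\<close> in the support
  and all samples, then integrating this bound against a nearly optimal coupling of \<open>P\<close> with the
  empirical distribution gives \<open>\<lambda> * \<epsilon> + (1/N) * (\<Sum>i. \<sigma> i)\<close> as an upper bound for the expected loss. A
  feasible point of the finite problem provides such a bound with \<open>\<sigma> i = (\<Sum>k. s i k)\<close>: adding the
  nonnegative slack \<open>\<gamma> * (d - C t)\<close> to a piece \<open>a t + b\<close> leaves an affine function whose slope has
  absolute value at most \<open>\<lambda>\<close> and whose value at the sample is at most \<open>s i k\<close>.

  Strong direction (\<open>wasserstein_multiplier_exists\<close>): the pairs (transport cost, expected loss) reached by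
  finitely supported couplings form a convex subset of the plane, which for \<open>\<epsilon> > 0\<close> can be separated
  from the quadrant of pairs with cost at most \<open>\<epsilon>\<close> and loss above the worst case. The slope of the
  separating line is the multiplier, so a multiplier closing the gap is attained and not merely
  approximated. The quadrant extends to cost values below \<open>\<epsilon>\<close>, so the slope has the right
  sign, and the zero-cost coupling excludes a vertical line; this last point fails at \<open>\<epsilon> = 0\<close>,
  where instead any Lipschitz constant of \<open>f\<close> serves as multiplier.

  It remains to turn a multiplier into a point of the finite problem. Transport to one target per
  sample gives a bound on a sum over \<open>(i, k)\<close> of functions of independent variables, so the suprema \<open>s i k\<close> of the
  summands obey the same bound (\<open>sum_Sup_le\<close>). That \<open>s i k\<close> dominates each piece
  minus \<open>\<lambda> * \<bar>t - \<xi>h i $ k\<bar>\<close> on a polyhedral interval is certified by some \<open>\<gamma>\<close>, by an elementary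
  one-dimensional form of linear programming duality (\<open>polyhedron1_multiplier\<close>).

  Hence for every \<open>x\<close> the worst case is the minimum, not only the infimum, of the finite problem over
  its remaining variables, and both claims follow by minimizing fibrewise
  (\<open>INF_and_minimizers_by_fibres\<close>).\<close>

section \<open>Norms in coordinates\<close>

lemma dual_norm_l1_real: "dual_norm l1_norm (z::real) = \<bar>z\<bar>"
proof -
  have "(SUP v\<in>{v::real. \<bar>v\<bar> \<le> 1}. z * v) = \<bar>z\<bar>"
  proof (rule cSup_eq_maximum)
    show "\<bar>z\<bar> \<in> (*) z ` {v. \<bar>v\<bar> \<le> 1}"
      by (rule image_eqI[where x = "sgn z"]) (auto simp: abs_sgn sgn_if)
    show "y \<le> \<bar>z\<bar>" if "y \<in> (*) z ` {v. \<bar>v\<bar> \<le> 1}" for y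
    proof -
      from that obtain v where v: "y = z * v" "\<bar>v\<bar> \<le> 1" by auto
      have "\<bar>z * v\<bar> \<le> \<bar>z\<bar> * 1" unfolding abs_mult by (intro mult_left_mono v) simp
      then show ?thesis using v by linarith
    qed
  qed
  then show ?thesis by (simp add: dual_norm_def l1_norm_def)
qed

lemma l1_norm_vec: "l1_norm (v :: real ^ 'k) = (\<Sum>k\<in>UNIV. \<bar>v $ k\<bar>)"
proof -
  have "l1_norm v = (\<Sum>b\<in>(\<lambda>k. axis k 1) ` UNIV. \<bar>v \<bullet> b\<bar>)"
    unfolding l1_norm_def Basis_vec_def by (intro sum.cong) auto
  also have "\<dots> = (\<Sum>k\<in>UNIV. \<bar>v $ k\<bar>)"
    by (subst sum.reindex) (auto simp: inj_on_def axis_eq_axis inner_axis)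
  finally show ?thesis .
qed

section \<open>Certificates for affine functions on polyhedral intervals\<close>

text \<open>If the slope exceeds \<open>lam\<close>, the penalized function \<open>a * t + b - lam * \<bar>t - h\<bar>\<close> still grows to the right
  of \<open>h\<close>, so it can only be bounded if some constraint caps \<open>t\<close> from above. The tightest such
  constraint alone carries the multiplier: putting weight \<open>(a - lam) / c r\<close> on it lowers the slope to
  exactly \<open>lam\<close>, and the certified value is the penalized value at the right end point.\<close>

lemma polyhedron1_multiplier_above:
  fixes n :: nat
  assumes h: "h \<in> polyhedron1 n c e" and lam: "0 \<le> lam" "lam < a"
    and le: "\<And>t. t \<in> polyhedron1 n c e \<Longrightarrow> a * t + b - lam * \<bar>t - h\<bar> \<le> s"
  shows "\<exists>g. (\<forall>r\<in>{1..n}. 0 \<le> g r) \<and> (\<Sum>r=1..n. c r * g r) - a = - lam \<and>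
    b + a * h + (\<Sum>r=1..n. g r * (e r - c r * h)) \<le> s"
proof -
  define R where "R = {r\<in>{1..n}. c r > 0}"
  have ch: "c r * h \<le> e r" if "r \<in> {1..n}" for r
    using h that by (auto simp: polyhedron1_def)
  have feas: "t \<in> polyhedron1 n c e" if "h \<le> t" "\<And>r. r \<in> R \<Longrightarrow> t \<le> e r / c r" for t
    unfolding polyhedron1_def
  proof safe
    fix r assume r: "r \<in> {1..n}"
    show "c r * t \<le> e r"
    proof (cases "c r > 0")
      case True
      with that(2)[of r] r show ?thesis by (simp add: R_def field_simps)
    next
      case False
      then have "c r * t \<le> c r * h" using that(1) by (intro mult_left_mono_neg) auto
      with ch[OF r] show ?thesis by linarith
    qed
  qed
  have "R \<noteq> {}"
  proof
    assume R: "R = {}"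
    \<comment> \<open>Without an upper cap this point is feasible, and the excess slope over \<open>lam\<close> lifts the value above \<open>s\<close>.\<close>
    define t where "t = h + (\<bar>s - b - a * h\<bar> + 1) / (a - lam)"
    have th: "h \<le> t" "(a - lam) * (t - h) = \<bar>s - b - a * h\<bar> + 1" using lam by (auto simp: t_def)
    have "a * t + b - lam * \<bar>t - h\<bar> \<le> s"
      by (rule le, rule feas) (use R th in auto)
    moreover have "a * t + b - lam * \<bar>t - h\<bar> = b + a * h + (a - lam) * (t - h)"
      using th(1) by (simp add: algebra_simps)
    ultimately show False using th(2) by linarith
  qed
  moreover have "finite R" by (simp add: R_def)
  ultimately obtain r where r: "r \<in> R" and rmin: "\<And>q. q \<in> R \<Longrightarrow> e r / c r \<le> e q / c q"
    using ex_min_if_finite[of "(\<lambda>r. e r / c r) ` R"] by (fastforce simp: not_less)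
  define t where "t = e r / c r"
  have rr: "r \<in> {1..n}" "c r > 0" using r by (auto simp: R_def)
  have th: "h \<le> t" using ch[OF rr(1)] rr(2) by (simp add: t_def field_simps)
  have le_t: "a * t + b - lam * \<bar>t - h\<bar> \<le> s"
    by (rule le, rule feas) (use th rmin in \<open>auto simp: t_def\<close>)
  define g where "g q = (if q = r then (a - lam) / c r else 0)" for q
  have "(\<Sum>q=1..n. c q * g q) = a - lam"
    using rr by (simp add: g_def if_distrib[of "\<lambda>x. _ * x"] sum.delta cong: if_cong)
  moreover have "(\<Sum>q=1..n. g q * (e q - c q * h)) = (a - lam) * (t - h)"
  proof -
    have "(\<Sum>q=1..n. g q * (e q - c q * h)) = g r * (e r - c r * h)"
      using rr(1) by (simp add: g_def if_distrib[of "\<lambda>x. x * _"] sum.delta cong: if_cong)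
    also have "\<dots> = (a - lam) * (t - h)"
      using rr(2) by (simp add: g_def t_def field_simps)
    finally show ?thesis .
  qed
  moreover have "0 \<le> g q" for q using lam rr by (simp add: g_def)
  ultimately show ?thesis using le_t th
    by (intro exI[of _ g]) (auto simp: algebra_simps)
qed

lemma polyhedron1_reflect: "t \<in> polyhedron1 n (\<lambda>r. - c r) e \<longleftrightarrow> - t \<in> polyhedron1 n c e"
  by (simp add: polyhedron1_def)

text \<open>The one-dimensional duality: a penalized bound on the interval always has a multiplier. When
  \<open>\<bar>a\<bar> \<le> lam\<close> the penalty dominates the slope, the maximum sits at \<open>h\<close>, and \<open>g = 0\<close> works; steep
  negative slopes reduce to steep positive ones by reflection.\<close>

lemma polyhedron1_multiplier:
  fixes n :: nat
  assumes h: "h \<in> polyhedron1 n c e" and lam: "0 \<le> lam"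
    and le: "\<And>t. t \<in> polyhedron1 n c e \<Longrightarrow> a * t + b - lam * \<bar>t - h\<bar> \<le> s"
  shows "\<exists>g. (\<forall>r\<in>{1..n}. 0 \<le> g r) \<and> \<bar>(\<Sum>r=1..n. c r * g r) - a\<bar> \<le> lam \<and>
    b + a * h + (\<Sum>r=1..n. g r * (e r - c r * h)) \<le> s"
proof -
  consider "\<bar>a\<bar> \<le> lam" | "lam < a" | "lam < - a" using lam by linarith
  then show ?thesis
  proof cases
    case 1
    with le[OF h] show ?thesis by (intro exI[of _ "\<lambda>_. 0"]) (auto simp: algebra_simps)
  next
    case 2
    from polyhedron1_multiplier_above[OF h lam 2 le] lam show ?thesis by fastforce
  next
    case 3
    have "\<exists>g. (\<forall>r\<in>{1..n}. 0 \<le> g r) \<and> (\<Sum>r=1..n. - c r * g r) - (- a) = - lam \<and>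
        b + - a * - h + (\<Sum>r=1..n. g r * (e r - - c r * - h)) \<le> s"
    proof (rule polyhedron1_multiplier_above[OF _ lam 3])
      show "- h \<in> polyhedron1 n (\<lambda>r. - c r) e" using h by (simp add: polyhedron1_reflect)
      show "- a * t + b - lam * \<bar>t - - h\<bar> \<le> s" if "t \<in> polyhedron1 n (\<lambda>r. - c r) e" for t
        using le[of "- t"] that abs_minus_commute[of "- t" h]
        by (simp add: polyhedron1_reflect add.commute[of h t])
    qed
    then obtain g where "\<forall>r\<in>{1..n}. 0 \<le> g r" "(\<Sum>r=1..n. - c r * g r) - (- a) = - lam"
        "b + - a * - h + (\<Sum>r=1..n. g r * (e r - - c r * - h)) \<le> s" by blast
    with lam show ?thesis by (intro exI[of _ g]) (auto simp: sum_negf)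
  qed
qed

text \<open>The easy converse: a multiplier bounds the affine function at every feasible point, because the
  slack terms \<open>g r * (e r - c r * t)\<close> are nonnegative and the combined slope is at most \<open>lam\<close>.\<close>

lemma polyhedron1_multiplier_bound:
  fixes n :: nat
  assumes t: "t \<in> polyhedron1 n c e" and g: "\<And>r. r \<in> {1..n} \<Longrightarrow> 0 \<le> g r"
    and lam: "\<bar>(\<Sum>r=1..n. c r * g r) - a\<bar> \<le> lam"
    and s: "b + a * h + (\<Sum>r=1..n. g r * (e r - c r * h)) \<le> s"
  shows "a * t + b \<le> s + lam * \<bar>t - h\<bar>"
proof -
  let ?G = "\<Sum>r=1..n. c r * g r"
  have "0 \<le> (\<Sum>r=1..n. g r * (e r - c r * t))"
    using t g by (intro sum_nonneg mult_nonneg_nonneg) (auto simp: polyhedron1_def)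
  also have "\<dots> = (\<Sum>r=1..n. g r * (e r - c r * h)) - ?G * (t - h)"
    by (simp add: sum_distrib_left sum_subtractf algebra_simps)
  finally have 1: "?G * (t - h) \<le> (\<Sum>r=1..n. g r * (e r - c r * h))" by simp
  have "\<bar>(a - ?G) * (t - h)\<bar> \<le> lam * \<bar>t - h\<bar>"
    unfolding abs_mult using lam by (intro mult_right_mono) auto
  with 1 s show ?thesis by (simp add: algebra_simps)
qed

section \<open>The empirical distribution\<close>

text \<open>Viewing the uniform index as a probability mass function makes integrals and null sets of the
  empirical distribution finite, and supplies the second marginal of the couplings built below.\<close>

lemma empirical_eq_pmf:
  assumes "N \<ge> 1"
  shows "empirical N \<xi>h = distr (measure_pmf (pmf_of_set {1..N})) borel \<xi>h"
proof (rule measure_eqI)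
  fix A assume "A \<in> sets (empirical N \<xi>h)"
  then have A: "A \<in> sets borel" by (simp add: empirical_def)
  have ne: "{1..N} \<noteq> {}" using assms by auto
  have "emeasure (empirical N \<xi>h) A = emeasure (uniform_count_measure {1..N}) (\<xi>h -` A \<inter> {1..N})"
    using A unfolding empirical_def
    by (subst emeasure_distr) (auto simp: space_uniform_count_measure measurable_def sets_uniform_count_measure)
  also have "\<dots> = emeasure (distr (measure_pmf (pmf_of_set {1..N})) borel \<xi>h) A"
    using A ne assms
    by (simp add: emeasure_uniform_count_measure emeasure_distr emeasure_pmf_of_set Int_commute
        ennreal_of_nat_eq_real_of_nat divide_ennreal)
  finally show "emeasure (empirical N \<xi>h) A = \<dots>" .
qed (simp add: empirical_def)

lemma integral_empirical:
  fixes g :: "real ^ 'k \<Rightarrow> real"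
  assumes "N \<ge> 1" "g \<in> borel_measurable borel"
  shows "(\<integral>z. g z \<partial>empirical N \<xi>h) = 1 / real N * (\<Sum>i=1..N. g (\<xi>h i))"
  using assms by (simp add: empirical_eq_pmf integral_distr integral_pmf_of_set)

lemma AE_empirical_iff:
  assumes "N \<ge> 1" "{z. Q z} \<in> sets borel"
  shows "(AE z in empirical N \<xi>h. Q z) \<longleftrightarrow> (\<forall>i\<in>{1..N}. Q (\<xi>h i))"
  unfolding empirical_eq_pmf[OF assms(1)]
  using assms by (subst AE_distr_iff) (auto simp: AE_measure_pmf_iff)

section \<open>Duality for the Wasserstein ball\<close>

lemma borel_measurable_finite_support:
  fixes h :: "real ^ 'k \<Rightarrow> real"
  assumes "finite Z" "\<And>z. z \<notin> Z \<Longrightarrow> h z = 0"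
  shows "h \<in> borel_measurable borel"
proof -
  have "h = (\<lambda>z. \<Sum>w\<in>Z. indicator {w} z * h w)"
  proof
    fix z
    show "h z = (\<Sum>w\<in>Z. indicator {w} z * h w)"
      using assms by (cases "z \<in> Z") (auto simp: indicator_def sum.delta if_distrib cong: if_cong)
  qed
  moreover have "(\<lambda>z. \<Sum>w\<in>Z. indicator {w} z * h w) \<in> borel_measurable borel" by measurable
  ultimately show ?thesis by simp
qed

text \<open>The bound integrates against a coupling only as a function of the pair of points, while \<open>s\<close> depends on
  the index of the sample. Samples may coincide, so at a point \<open>z\<close> the proof uses the least \<open>s i\<close> over
  all samples equal to \<open>z\<close>; its empirical mean is at most that of \<open>s\<close>. Since the infimum in the
  Wasserstein metric need not be attained, couplings of cost below \<open>\<epsilon> + \<delta>\<close> are used.\<close>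

lemma wasserstein_weak_duality:
  fixes f :: "real ^ 'k \<Rightarrow> real"
  assumes N: "N \<ge> 1" and eps: "\<epsilon> \<ge> 0" and lam: "lam \<ge> 0" and \<Xi>[measurable]: "\<Xi> \<in> sets borel"
    and P: "P \<in> wasserstein_ball \<Xi> (empirical N \<xi>h) \<epsilon>"
    and f: "set_integrable P \<Xi> f"
    and bound: "\<And>i \<xi>. i \<in> {1..N} \<Longrightarrow> \<xi> \<in> \<Xi> \<Longrightarrow> f \<xi> \<le> lam * l1_norm (\<xi> - \<xi>h i) + s i"
  shows "(LINT \<xi>:\<Xi>|P. f \<xi>) \<le> lam * \<epsilon> + 1 / real N * (\<Sum>i=1..N. s i)"
proof -
  define F where "F = (\<lambda>\<xi>. indicator \<Xi> \<xi> * f \<xi>)"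
  define Z where "Z = \<xi>h ` {1..N}"
  define h where "h z = (if z \<in> Z then Min (s ` {i\<in>{1..N}. \<xi>h i = z}) else 0)" for z
  have Z[measurable]: "finite Z" "Z \<in> sets borel" by (auto simp: Z_def intro!: borel_closed finite_imp_closed)
  have h_le: "h (\<xi>h i) \<le> s i" if "i \<in> {1..N}" for i
    using that by (auto simp: h_def Z_def intro!: Min_le)
  have h_ge: "f \<xi> \<le> lam * l1_norm (\<xi> - z) + h z" if "\<xi> \<in> \<Xi>" "z \<in> Z" for \<xi> z
  proof -
    let ?I = "{i\<in>{1..N}. \<xi>h i = z}"
    have "Min (s ` ?I) \<in> s ` ?I" using that(2) by (intro Min_in) (auto simp: Z_def)
    then obtain i where "i \<in> {1..N}" "\<xi>h i = z" "Min (s ` ?I) = s i" by auto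
    with bound[of i \<xi>] that show ?thesis by (simp add: h_def)
  qed
  have hm[measurable]: "h \<in> borel_measurable borel"
    by (rule borel_measurable_finite_support[OF Z(1)]) (simp add: h_def)
  have sP: "sets P = sets borel" and AEP: "AE \<xi> in P. \<xi> \<in> \<Xi>"
    and W: "wasserstein P (empirical N \<xi>h) \<le> ennreal \<epsilon>"
    using P by (auto simp: wasserstein_ball_def prob_dists_def)
  have FP: "integrable P F" using f by (simp add: F_def set_integrable_def)
  have Fm[measurable]: "F \<in> borel_measurable borel"
    using borel_measurable_integrable[OF FP] sP by (simp cong: measurable_cong_sets)
  have l1m[measurable]: "l1_norm \<in> borel_measurable (borel :: (real ^ 'k) measure)"
    unfolding l1_norm_def by measurable
  have step: "(LINT \<xi>:\<Xi>|P. f \<xi>) \<le> lam * (\<epsilon> + \<delta>) + 1 / real N * (\<Sum>i=1..N. s i)" if "\<delta> > 0" for \<delta>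
  proof -
    have "wasserstein P (empirical N \<xi>h) < ennreal (\<epsilon> + \<delta>)"
      using W eps that by (auto simp: ennreal_less_iff intro: le_less_trans)
    then obtain \<pi> where pi: "\<pi> \<in> couplings P (empirical N \<xi>h)"
      and cost: "(\<integral>\<^sup>+(\<xi>, \<zeta>). ennreal (l1_norm (\<xi> - \<zeta>)) \<partial>\<pi>) < ennreal (\<epsilon> + \<delta>)"
      by (auto simp: wasserstein_def INF_less_iff)
    have spi[measurable_cong]: "sets \<pi> = sets (borel \<Otimes>\<^sub>M borel)"
      and d1: "distr \<pi> borel fst = P" and d2: "distr \<pi> borel snd = empirical N \<xi>h"
      using pi by (auto simp: couplings_def)
    interpret prob_space \<pi> using pi by (simp add: couplings_def)
    define c where "c = (\<lambda>p :: (real ^ 'k) \<times> (real ^ 'k). l1_norm (fst p - snd p))"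
    have cm[measurable]: "c \<in> borel_measurable \<pi>" unfolding c_def by measurable
    have c0: "c p \<ge> 0" for p by (simp add: c_def l1_norm_vec sum_nonneg)
    have nn: "(\<integral>\<^sup>+p. ennreal (c p) \<partial>\<pi>) < ennreal (\<epsilon> + \<delta>)"
      using cost by (simp add: c_def case_prod_unfold)
    have ci: "integrable \<pi> c"
      using nn c0 by (intro integrableI_nonneg) (auto intro: less_trans)
    have cle: "(\<integral>p. c p \<partial>\<pi>) \<le> \<epsilon> + \<delta>"
      using nn c0 ci eps that
      by (subst (asm) nn_integral_eq_integral) (auto simp: ennreal_less_iff simp del: ennreal_plus)
    have Fi: "integrable \<pi> (\<lambda>p. F (fst p))"
      using FP by (subst (asm) d1[symmetric], subst (asm) integrable_distr_eq) auto
    have hi: "integrable \<pi> (\<lambda>p. h (snd p))"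
    proof (rule integrable_const_bound)
      have "\<bar>h z\<bar> \<le> (\<Sum>w\<in>Z. \<bar>h w\<bar>)" for z
        using Z(1) by (cases "z \<in> Z") (auto intro: member_le_sum sum_nonneg simp: h_def)
      then show "AE p in \<pi>. norm (h (snd p)) \<le> (\<Sum>w\<in>Z. \<bar>h w\<bar>)" by simp
    qed measurable
    have "AE p in \<pi>. fst p \<in> \<Xi>"
      using AEP by (subst (asm) d1[symmetric], subst (asm) AE_distr_iff) auto
    moreover have "AE z in empirical N \<xi>h. z \<in> Z"
      using AE_empirical_iff[OF N, of "\<lambda>z. z \<in> Z" \<xi>h] Z(2) by (simp add: Z_def)
    then have "AE p in \<pi>. snd p \<in> Z"
      by (subst (asm) d2[symmetric], subst (asm) AE_distr_iff) auto
    ultimately have ae: "AE p in \<pi>. F (fst p) \<le> lam * c p + h (snd p)"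
      by eventually_elim (auto simp: F_def c_def intro: h_ge)
    have "(LINT \<xi>:\<Xi>|P. f \<xi>) = (\<integral>p. F (fst p) \<partial>\<pi>)"
      unfolding set_lebesgue_integral_def d1[symmetric]
      using Fm by (subst integral_distr) (auto simp: F_def)
    also have "\<dots> \<le> (\<integral>p. lam * c p + h (snd p) \<partial>\<pi>)"
      using ae Fi ci hi by (intro integral_mono_AE) auto
    also have "\<dots> = lam * (\<integral>p. c p \<partial>\<pi>) + (\<integral>p. h (snd p) \<partial>\<pi>)" using ci hi by simp
    also have "(\<integral>p. h (snd p) \<partial>\<pi>) = (\<integral>z. h z \<partial>empirical N \<xi>h)"
      unfolding d2[symmetric] by (subst integral_distr) auto
    also have "\<dots> = 1 / real N * (\<Sum>i=1..N. h (\<xi>h i))" by (rule integral_empirical[OF N hm])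
    also have "\<dots> \<le> 1 / real N * (\<Sum>i=1..N. s i)"
      by (intro mult_left_mono sum_mono h_le) auto
    finally show ?thesis using mult_left_mono[OF cle lam] by linarith
  qed
  show ?thesis
  proof (rule field_le_epsilon)
    fix e :: real assume e: "e > 0"
    define \<delta> where "\<delta> = e / (lam + 1)"
    have "\<delta> > 0" "lam * \<delta> \<le> e" using e lam by (auto simp: \<delta>_def field_simps)
    with step[of \<delta>] show "(LINT \<xi>:\<Xi>|P. f \<xi>) \<le> lam * \<epsilon> + 1 / real N * (\<Sum>i=1..N. s i) + e"
      by (simp add: distrib_left)
  qed
qed

text \<open>The second component records the index of a sample rather than its location: conditional on each
  index the target can then be chosen freely, even if samples coincide.\<close>

definition finite_couplings :: "(real ^ 'k) set \<Rightarrow> nat \<Rightarrow> ((real ^ 'k) \<times> nat) pmf set" where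
  "finite_couplings \<Xi> N =
    {q. finite (set_pmf q) \<and> fst ` set_pmf q \<subseteq> \<Xi> \<and> map_pmf snd q = pmf_of_set {1..N}}"

text \<open>The source of convexity in the strong direction: one mixed coupling interpolates the expectations of
  all functions at once, in particular cost and loss simultaneously.\<close>

lemma finite_couplings_mixture:
  assumes q: "q1 \<in> finite_couplings \<Xi> N" "q2 \<in> finite_couplings \<Xi> N" and u: "0 \<le> u" "0 \<le> v" "u + v = 1"
  shows "\<exists>q\<in>finite_couplings \<Xi> N. \<forall>g :: (real ^ 'k) \<times> nat \<Rightarrow> real.
    measure_pmf.expectation q g = u * measure_pmf.expectation q1 g + v * measure_pmf.expectation q2 g"
proof
  define q where "q = bind_pmf (bernoulli_pmf u) (\<lambda>b. if b then q1 else q2)"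
  have fin: "finite (set_pmf q1)" "finite (set_pmf q2)" using q by (auto simp: finite_couplings_def)
  have set: "set_pmf q \<subseteq> set_pmf q1 \<union> set_pmf q2" unfolding q_def set_bind_pmf by (auto split: if_splits)
  have "map_pmf snd q = bind_pmf (bernoulli_pmf u) (\<lambda>_. pmf_of_set {1..N})"
    unfolding q_def map_bind_pmf using q by (intro bind_pmf_cong) (simp_all add: finite_couplings_def)
  then have "map_pmf snd q = pmf_of_set {1..N}" by simp
  moreover have "finite (set_pmf q)" using set fin by (rule finite_subset[OF _ finite_UnI])
  moreover have "fst ` set_pmf q \<subseteq> \<Xi>" 
  proof -
    have "fst ` set_pmf q1 \<subseteq> \<Xi>" "fst ` set_pmf q2 \<subseteq> \<Xi>" using q by (simp_all add: finite_couplings_def)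
    then show ?thesis using set by blast
  qed
  ultimately show "q \<in> finite_couplings \<Xi> N" by (simp add: finite_couplings_def)
  have pmf: "pmf q x = u * pmf q1 x + v * pmf q2 x" for x
  proof -
    have "v = 1 - u" using u by simp
    then show ?thesis using u by (simp add: q_def pmf_bind)
  qed
  show "\<forall>g. measure_pmf.expectation q g =
      u * measure_pmf.expectation q1 g + v * measure_pmf.expectation q2 g"
  proof
    fix g :: "(real ^ 'k) \<times> nat \<Rightarrow> real"
    let ?A = "set_pmf q1 \<union> set_pmf q2"
    have E: "measure_pmf.expectation r g = (\<Sum>x\<in>?A. g x * pmf r x)" if "set_pmf r \<subseteq> ?A" for r
      using fin that by (intro integral_measure_pmf_real) auto
    show "measure_pmf.expectation q g = u * measure_pmf.expectation q1 g + v * measure_pmf.expectation q2 g"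
      unfolding E[OF set] E[OF Un_upper1] E[OF Un_upper2]
      by (simp add: pmf distrib_left sum.distrib sum_distrib_left mult.left_commute)
  qed
qed

text \<open>Couplings of cost at most \<open>\<epsilon>\<close> stay inside the ambiguity set, so their expected loss cannot exceed the
  worst case.\<close>

lemma finite_couplings_ball:
  fixes f :: "real ^ 'k \<Rightarrow> real"
  assumes N: "N \<ge> 1" and \<Xi>[measurable]: "\<Xi> \<in> sets borel"
    and f: "(\<lambda>\<xi>. indicator \<Xi> \<xi> * f \<xi>) \<in> borel_measurable borel"
    and q: "q \<in> finite_couplings \<Xi> N"
    and cost: "measure_pmf.expectation q (\<lambda>(y, i). l1_norm (y - \<xi>h i)) \<le> \<epsilon>"
  shows "\<exists>P\<in>wasserstein_ball \<Xi> (empirical N \<xi>h) \<epsilon>.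
    (LINT \<xi>:\<Xi>|P. f \<xi>) = measure_pmf.expectation q (\<lambda>(y, i). f y)"
proof
  define P where "P = distr (measure_pmf q) borel fst"
  define \<pi> where "\<pi> = distr (measure_pmf q) (borel \<Otimes>\<^sub>M borel) (\<lambda>(y, i). (y, \<xi>h i))"
  have fin: "finite (set_pmf q)" and sup: "fst ` set_pmf q \<subseteq> \<Xi>"
    and marg: "map_pmf snd q = pmf_of_set {1..N}" using q by (auto simp: finite_couplings_def)
  note int = integrable_measure_pmf_finite[OF fin]
  have l1m[measurable]: "l1_norm \<in> borel_measurable (borel :: (real ^ 'k) measure)"
    unfolding l1_norm_def by measurable
  have 1: "distr \<pi> borel fst = P"
    unfolding \<pi>_def P_def by (subst distr_distr) (auto simp: o_def case_prod_unfold space_pair_measure)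
  have 2: "distr \<pi> borel snd = empirical N \<xi>h"
    unfolding \<pi>_def empirical_eq_pmf[OF N] marg[symmetric] map_pmf_rep_eq
    by (subst (1 2) distr_distr) (auto simp: o_def case_prod_unfold space_pair_measure)
  have "\<pi> \<in> couplings P (empirical N \<xi>h)"
    unfolding couplings_def using 1 2
    by (auto simp: \<pi>_def space_pair_measure intro!: measure_pmf.prob_space_distr)
  then have "wasserstein P (empirical N \<xi>h) \<le> (\<integral>\<^sup>+(\<xi>, \<zeta>). ennreal (l1_norm (\<xi> - \<zeta>)) \<partial>\<pi>)"
    unfolding wasserstein_def by (rule INF_lower)
  also have "\<dots> = (\<integral>\<^sup>+(y, i). ennreal (l1_norm (y - \<xi>h i)) \<partial>measure_pmf q)"
    unfolding \<pi>_def by (subst nn_integral_distr) (auto simp: case_prod_unfold space_pair_measure)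
  also have "\<dots> = ennreal (measure_pmf.expectation q (\<lambda>(y, i). l1_norm (y - \<xi>h i)))"
    unfolding case_prod_unfold
    by (intro nn_integral_eq_integral int) (auto simp: l1_norm_vec sum_nonneg)
  also have "\<dots> \<le> ennreal \<epsilon>" using cost by (rule ennreal_leI)
  finally have W: "wasserstein P (empirical N \<xi>h) \<le> ennreal \<epsilon>" .
  have "AE \<xi> in P. \<xi> \<in> \<Xi>"
    unfolding P_def using sup by (subst AE_distr_iff) (auto simp: AE_measure_pmf_iff)
  moreover have "integrable P l1_norm"
    unfolding P_def by (subst integrable_distr_eq) (auto intro: int)
  ultimately show "P \<in> wasserstein_ball \<Xi> (empirical N \<xi>h) \<epsilon>"
    using W by (auto simp: wasserstein_ball_def prob_dists_def, auto simp: P_def intro!: measure_pmf.prob_space_distr)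
  have "(LINT \<xi>:\<Xi>|P. f \<xi>) = measure_pmf.expectation q (\<lambda>p. indicator \<Xi> (fst p) * f (fst p))"
    unfolding P_def set_lebesgue_integral_def using f by (subst integral_distr) auto
  also have "\<dots> = measure_pmf.expectation q (\<lambda>(y, i). f y)"
    using sup by (intro integral_cong_AE) (auto simp: AE_measure_pmf_iff)
  finally show "(LINT \<xi>:\<Xi>|P. f \<xi>) = \<dots>" .
qed

lemma finite_couplings_transport:
  fixes y :: "nat \<Rightarrow> real ^ 'k" and g :: "(real ^ 'k) \<times> nat \<Rightarrow> real"
  assumes "N \<ge> 1" and "\<forall>i\<in>{1..N}. y i \<in> \<Xi>"
  defines "q \<equiv> map_pmf (\<lambda>i. (y i, i)) (pmf_of_set {1..N})"
  shows "q \<in> finite_couplings \<Xi> N"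
    and "measure_pmf.expectation q g = 1 / real N * (\<Sum>i=1..N. g (y i, i))"
  using assms by (auto simp: finite_couplings_def q_def map_pmf_comp integral_pmf_of_set)

text \<open>The separation argument. The resulting line bounds loss minus \<open>lam\<close> times cost over all finite
  couplings; the conclusion states it for those that move each sample to a single target.\<close>

lemma wasserstein_multiplier_exists:
  fixes f :: "real ^ 'k \<Rightarrow> real"
  assumes N: "N \<ge> 1" and eps: "\<epsilon> > 0" and \<Xi>[measurable]: "\<Xi> \<in> sets borel"
    and h: "\<forall>i\<in>{1..N}. \<xi>h i \<in> \<Xi>"
    and f: "(\<lambda>\<xi>. indicator \<Xi> \<xi> * f \<xi>) \<in> borel_measurable borel"
    and V: "\<And>P. P \<in> wasserstein_ball \<Xi> (empirical N \<xi>h) \<epsilon> \<Longrightarrow> (LINT \<xi>:\<Xi>|P. f \<xi>) \<le> V"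
  shows "\<exists>lam\<ge>0. \<forall>y. (\<forall>i\<in>{1..N}. y i \<in> \<Xi>) \<longrightarrow>
    1 / real N * (\<Sum>i=1..N. f (y i) - lam * l1_norm (y i - \<xi>h i)) \<le> V - lam * \<epsilon>"
proof -
  let ?c = "\<lambda>q. measure_pmf.expectation q (\<lambda>(y, i). l1_norm (y - \<xi>h i))"
  let ?v = "\<lambda>q. measure_pmf.expectation q (\<lambda>(y, i). f y)"
  define S where "S = (\<lambda>q. (?c q, ?v q)) ` finite_couplings \<Xi> N"
  define T where "T = {..\<epsilon>} \<times> {V<..}"
  have "convex S"
  proof (rule convexI)
    fix p1 p2 and u v :: real
    assume p: "p1 \<in> S" "p2 \<in> S" and u: "0 \<le> u" "0 \<le> v" "u + v = 1"
    from p obtain q1 q2 where q: "q1 \<in> finite_couplings \<Xi> N" "q2 \<in> finite_couplings \<Xi> N"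
      "p1 = (?c q1, ?v q1)" "p2 = (?c q2, ?v q2)" by (auto simp: S_def)
    from finite_couplings_mixture[OF q(1,2) u] obtain q where "q \<in> finite_couplings \<Xi> N"
      and "\<And>g. measure_pmf.expectation q g =
        u * measure_pmf.expectation q1 g + v * measure_pmf.expectation q2 g" by blast
    then show "u *\<^sub>R p1 + v *\<^sub>R p2 \<in> S"
      unfolding S_def q by (intro image_eqI[where x = q]) simp_all
  qed
  moreover have "convex T" unfolding T_def by (intro convex_Times) auto
  moreover have tr: "(1 / real N * (\<Sum>i=1..N. l1_norm (y i - \<xi>h i)), 1 / real N * (\<Sum>i=1..N. f (y i))) \<in> S"
    if "\<forall>i\<in>{1..N}. y i \<in> \<Xi>" for y
  proof -
    define q where "q = map_pmf (\<lambda>i. (y i, i)) (pmf_of_set {1..N})"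
    note q = finite_couplings_transport[OF N that, folded q_def]
    show ?thesis unfolding S_def by (rule image_eqI[OF _ q(1)]) (simp add: q(2))
  qed
  have S0: "(0, 1 / real N * (\<Sum>i=1..N. f (\<xi>h i))) \<in> S"
    using tr[of \<xi>h] h by (simp add: l1_norm_vec)
  moreover have "(\<epsilon>, V + 1) \<in> T" by (simp add: T_def)
  moreover have "S \<inter> T = {}"
  proof -
    have "?v q \<le> V" if "q \<in> finite_couplings \<Xi> N" "?c q \<le> \<epsilon>" for q
      using finite_couplings_ball[OF N \<Xi> f that] V by fastforce
    then show ?thesis by (force simp: S_def T_def)
  qed
  ultimately obtain n k where n: "n \<noteq> 0" "\<forall>x\<in>S. n \<bullet> x \<le> k" "\<forall>x\<in>T. n \<bullet> x \<ge> k"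
    using separating_hyperplane_sets[of S T] by blast
  obtain \<alpha> \<beta> where ab: "n = (- \<alpha>, \<beta>)" by (metis surj_pair minus_minus)
  have T: "k \<le> \<beta> * (V + v) - \<alpha> * (\<epsilon> - c)" if "c \<ge> 0" "v > 0" for c v
    using n(3)[rule_format, of "(\<epsilon> - c, V + v)"] that by (simp add: T_def ab algebra_simps)
  have Sle: "\<beta> * v - \<alpha> * c \<le> k" if "(c, v) \<in> S" for c v
    using n(2) that by (fastforce simp: ab)
  \<comment> \<open>A linear function bounded below on the positive half line has nonnegative slope: this gives the
    signs of \<open>\<alpha>\<close> and \<open>\<beta>\<close>, since \<open>T\<close> is unbounded in both coordinates.\<close>
  have grow: "0 \<le> z" if "\<And>t::real. t > 0 \<Longrightarrow> w \<le> z * t" for z w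
  proof (rule ccontr)
    assume "\<not> 0 \<le> z"
    then have "z * ((\<bar>w\<bar> + 1) / - z) = - (\<bar>w\<bar> + 1)" "(\<bar>w\<bar> + 1) / - z > 0"
      by (auto simp: field_simps)
    with that[of "(\<bar>w\<bar> + 1) / - z"] have "w \<le> - (\<bar>w\<bar> + 1)" by metis
    then show False by linarith
  qed
  have "\<alpha> \<ge> 0"
    by (rule grow[of "k - \<beta> * (V + 1) + \<alpha> * \<epsilon>"]) (use T[of _ 1] in \<open>force simp: algebra_simps\<close>)
  have "\<beta> \<ge> 0"
    by (rule grow[of "k - \<beta> * V + \<alpha> * \<epsilon>"]) (use T[of 0] in \<open>force simp: algebra_simps\<close>)
  have kle: "k \<le> \<beta> * V - \<alpha> * \<epsilon>"
  proof (rule field_le_epsilon)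
    fix e :: real assume "e > 0"
    have "\<beta> * (e / (\<beta> + 1)) \<le> e" using \<open>e > 0\<close> \<open>\<beta> \<ge> 0\<close> by (simp add: field_simps)
    with T[of 0 "e / (\<beta> + 1)"] \<open>e > 0\<close> \<open>\<beta> \<ge> 0\<close> show "k \<le> \<beta> * V - \<alpha> * \<epsilon> + e"
      by (simp add: distrib_left)
  qed
  \<comment> \<open>A vertical line would confine all costs to \<open>{\<epsilon>..}\<close>, but leaving the samples in place costs \<open>0 < \<epsilon>\<close>.\<close>
  have "\<beta> > 0"
  proof (rule ccontr)
    assume "\<not> \<beta> > 0"
    then have "\<beta> = 0" using \<open>\<beta> \<ge> 0\<close> by simp
    with n(1) ab \<open>\<alpha> \<ge> 0\<close> have "\<alpha> > 0" by (simp add: zero_prod_def)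
    then have "\<alpha> * \<epsilon> > 0" using eps by (rule mult_pos_pos)
    moreover have "0 \<le> k" using Sle[OF S0] \<open>\<beta> = 0\<close> by simp
    moreover have "k \<le> - (\<alpha> * \<epsilon>)" using kle \<open>\<beta> = 0\<close> by simp
    ultimately show False by linarith
  qed
  show ?thesis
  proof (intro exI[of _ "\<alpha> / \<beta>"] conjI allI impI)
    show "0 \<le> \<alpha> / \<beta>" using \<open>\<alpha> \<ge> 0\<close> \<open>\<beta> \<ge> 0\<close> by simp
    fix y assume "\<forall>i\<in>{1..N}. y i \<in> \<Xi>"
    from Sle[OF tr[OF this]] kle
    have "\<beta> * (1 / real N * (\<Sum>i=1..N. f (y i))) - \<alpha> * (1 / real N * (\<Sum>i=1..N. l1_norm (y i - \<xi>h i)))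
        \<le> \<beta> * V - \<alpha> * \<epsilon>" by linarith
    then have "1 / real N * (\<Sum>i=1..N. f (y i)) - \<alpha> / \<beta> * (1 / real N * (\<Sum>i=1..N. l1_norm (y i - \<xi>h i)))
        \<le> V - \<alpha> / \<beta> * \<epsilon>"
      using \<open>\<beta> > 0\<close> by (simp add: field_simps)
    then show "1 / real N * (\<Sum>i=1..N. f (y i) - \<alpha> / \<beta> * l1_norm (y i - \<xi>h i)) \<le> V - \<alpha> / \<beta> * \<epsilon>"
      by (simp only: sum_subtractf sum_distrib_left[symmetric] right_diff_distrib mult.left_commute)
  qed
qed


section \<open>Separable piecewise affine losses\<close>

definition separable_max ::
  "nat \<Rightarrow> (nat \<Rightarrow> 'k \<Rightarrow> real) \<Rightarrow> (nat \<Rightarrow> 'k \<Rightarrow> real) \<Rightarrow> real ^ 'k \<Rightarrow> real" where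
  "separable_max J a b \<xi> = (\<Sum>k\<in>UNIV. Max ((\<lambda>j. a j k * \<xi> $ k + b j k) ` {1..J}))"

text \<open>Each coordinate is dominated by the norm, whose integrability is part of membership in
  \<open>prob_dists\<close>.\<close>

lemma integrable_separable_max:
  fixes \<Xi> :: "(real ^ 'k) set"
  assumes P: "P \<in> prob_dists \<Xi>" and J: "J \<ge> 1"
  shows "integrable P (separable_max J a b)"
proof -
  have sP[measurable_cong]: "sets P = sets borel" and l1: "integrable P l1_norm"
    using P by (auto simp: prob_dists_def)
  interpret prob_space P using P by (simp add: prob_dists_def)
  have "integrable P (\<lambda>\<xi>. \<xi> $ k)" for k
  proof (rule Bochner_Integration.integrable_bound[OF l1])
    have "\<bar>\<xi> $ k\<bar> \<le> l1_norm \<xi>" for \<xi> :: "real ^ 'k"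
      unfolding l1_norm_vec by (rule member_le_sum) auto
    then show "AE \<xi> in P. norm (\<xi> $ k) \<le> norm (l1_norm \<xi>)"
      by (auto intro: order_trans[OF _ abs_ge_self])
  qed measurable
  then show ?thesis
    unfolding separable_max_def[abs_def] using J
    by (intro Bochner_Integration.integrable_sum integrable_MAX) auto
qed

lemma borel_measurable_separable_max [measurable]:
  "separable_max J a b \<in> borel_measurable borel"
  unfolding separable_max_def[abs_def] by measurable

lemma separable_max_lipschitz:
  fixes \<xi> \<zeta> :: "real ^ 'k"
  assumes J: "J \<ge> 1" and a: "\<And>j k. j \<in> {1..J} \<Longrightarrow> \<bar>a j k\<bar> \<le> lam"
  shows "separable_max J a b \<xi> \<le> separable_max J a b \<zeta> + lam * l1_norm (\<xi> - \<zeta>)"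
proof -
  have "Max ((\<lambda>j. a j k * \<xi> $ k + b j k) ` {1..J})
      \<le> Max ((\<lambda>j. a j k * \<zeta> $ k + b j k) ` {1..J}) + lam * \<bar>(\<xi> - \<zeta>) $ k\<bar>" for k
  proof (rule Max.boundedI)
    show "(\<lambda>j. a j k * \<xi> $ k + b j k) ` {1..J} \<noteq> {}" using J by simp
    fix v assume "v \<in> (\<lambda>j. a j k * \<xi> $ k + b j k) ` {1..J}"
    then obtain j where j: "j \<in> {1..J}" and v: "v = a j k * \<xi> $ k + b j k" by blast
    have "a j k * \<zeta> $ k + b j k \<le> Max ((\<lambda>j. a j k * \<zeta> $ k + b j k) ` {1..J})"
      using j by (intro Max_ge) auto
    moreover have "\<bar>a j k * (\<xi> - \<zeta>) $ k\<bar> \<le> lam * \<bar>(\<xi> - \<zeta>) $ k\<bar>"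
      unfolding abs_mult using a[OF j] by (intro mult_right_mono) auto
    ultimately show "v \<le> Max ((\<lambda>j. a j k * \<zeta> $ k + b j k) ` {1..J}) + lam * \<bar>(\<xi> - \<zeta>) $ k\<bar>"
      by (simp add: v right_diff_distrib)
  qed simp
  then have "separable_max J a b \<xi> \<le>
      (\<Sum>k\<in>UNIV. Max ((\<lambda>j. a j k * \<zeta> $ k + b j k) ` {1..J}) + lam * \<bar>(\<xi> - \<zeta>) $ k\<bar>)"
    unfolding separable_max_def by (rule sum_mono)
  also have "\<dots> = separable_max J a b \<zeta> + lam * l1_norm (\<xi> - \<zeta>)"
    by (simp add: separable_max_def l1_norm_vec sum.distrib sum_distrib_left)
  finally show ?thesis .
qed

text \<open>The constraints of the finite problem at a fixed decision, with the dual of the one-dimensional norm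
  written as an absolute value.\<close>

definition dual_certificate ::
  "nat \<Rightarrow> nat \<Rightarrow> (nat \<Rightarrow> real ^ 'k) \<Rightarrow> (nat \<Rightarrow> 'k \<Rightarrow> real) \<Rightarrow> (nat \<Rightarrow> 'k \<Rightarrow> real)
   \<Rightarrow> ('k \<Rightarrow> nat) \<Rightarrow> ('k \<Rightarrow> nat \<Rightarrow> real) \<Rightarrow> ('k \<Rightarrow> nat \<Rightarrow> real)
   \<Rightarrow> real \<Rightarrow> (nat \<Rightarrow> 'k \<Rightarrow> real) \<Rightarrow> (nat \<Rightarrow> nat \<Rightarrow> 'k \<Rightarrow> nat \<Rightarrow> real) \<Rightarrow> bool" where
  "dual_certificate N J \<xi>h a b m C d lam s \<gamma> \<longleftrightarrow>
    (\<forall>i\<in>{1..N}. \<forall>j\<in>{1..J}. \<forall>k.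
        b j k + a j k * \<xi>h i $ k + (\<Sum>r=1..m k. \<gamma> i j k r * (d k r - C k r * \<xi>h i $ k)) \<le> s i k \<and>
        \<bar>(\<Sum>r=1..m k. C k r * \<gamma> i j k r) - a j k\<bar> \<le> lam \<and>
        (\<forall>r\<in>{1..m k}. 0 \<le> \<gamma> i j k r))"

lemma dual_feasible_iff:
  "(x, lam, s, \<gamma>) \<in> dual_feasible X N J \<xi>h a b m C d \<longleftrightarrow>
    x \<in> X \<and> dual_certificate N J \<xi>h (a x) (b x) m C d lam s \<gamma>"
  by (simp add: dual_feasible_def dual_certificate_def dual_norm_l1_real)

lemma dual_certificate_bound:
  assumes J: "J \<ge> 1" and cert: "dual_certificate N J \<xi>h a b m C d lam s \<gamma>"
    and i: "i \<in> {1..N}" and \<xi>: "\<And>k. \<xi> $ k \<in> polyhedron1 (m k) (C k) (d k)"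
  shows "separable_max J a b \<xi> \<le> lam * l1_norm (\<xi> - \<xi>h i) + (\<Sum>k\<in>UNIV. s i k)"
proof -
  have "Max ((\<lambda>j. a j k * \<xi> $ k + b j k) ` {1..J}) \<le> s i k + lam * \<bar>\<xi> $ k - \<xi>h i $ k\<bar>" for k
  proof (rule Max.boundedI)
    show "(\<lambda>j. a j k * \<xi> $ k + b j k) ` {1..J} \<noteq> {}" using J by simp
    fix v assume "v \<in> (\<lambda>j. a j k * \<xi> $ k + b j k) ` {1..J}"
    then obtain j where j: "j \<in> {1..J}" and v: "v = a j k * \<xi> $ k + b j k" by blast
    show "v \<le> s i k + lam * \<bar>\<xi> $ k - \<xi>h i $ k\<bar>"
      unfolding v using cert i j
      by (intro polyhedron1_multiplier_bound[OF \<xi>, where g = "\<gamma> i j k"])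
        (simp_all add: dual_certificate_def)
  qed simp
  then have "separable_max J a b \<xi> \<le> (\<Sum>k\<in>UNIV. s i k + lam * \<bar>\<xi> $ k - \<xi>h i $ k\<bar>)"
    unfolding separable_max_def by (rule sum_mono)
  also have "\<dots> = lam * l1_norm (\<xi> - \<xi>h i) + (\<Sum>k\<in>UNIV. s i k)"
    by (simp add: l1_norm_vec sum.distrib sum_distrib_left)
  finally show ?thesis .
qed

lemma dual_certificate_nonneg:
  assumes "N \<ge> 1" "J \<ge> 1" "dual_certificate N J \<xi>h a b m C d lam s \<gamma>"
  shows "lam \<ge> 0"
proof -
  from assms have "\<bar>(\<Sum>r=1..m k. C k r * \<gamma> 1 1 k r) - a 1 k\<bar> \<le> lam" for k
    unfolding dual_certificate_def by force
  then show ?thesis by (meson abs_ge_zero order_trans)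
qed

text \<open>Since the variables \<open>t i\<close> range independently, the supremum of the sum is the sum of the suprema; a
  common bound also forces every single supremum to be finite.\<close>

lemma sum_Sup_le:
  fixes \<phi> :: "'i \<Rightarrow> 'a \<Rightarrow> real"
  assumes "finite I" and "\<And>i. i \<in> I \<Longrightarrow> T i \<noteq> {}"
    and "\<And>t. (\<forall>i\<in>I. t i \<in> T i) \<Longrightarrow> (\<Sum>i\<in>I. \<phi> i (t i)) \<le> W"
  shows "(\<forall>i\<in>I. bdd_above (\<phi> i ` T i)) \<and> (\<Sum>i\<in>I. Sup (\<phi> i ` T i)) \<le> W"
  using assms
proof (induction I arbitrary: W rule: finite_induct)
  case empty
  then show ?case by simp
next
  case (insert i I)
  have rest: "(\<forall>j\<in>I. bdd_above (\<phi> j ` T j)) \<and> (\<Sum>j\<in>I. Sup (\<phi> j ` T j)) \<le> W - \<phi> i u" if "u \<in> T i" for u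
  proof (rule insert.IH)
    show "(\<Sum>j\<in>I. \<phi> j (t j)) \<le> W - \<phi> i u" if t: "\<forall>j\<in>I. t j \<in> T j" for t
    proof -
      have "(\<Sum>j\<in>insert i I. \<phi> j ((t(i := u)) j)) \<le> W"
        using t \<open>u \<in> T i\<close> by (intro insert.prems(2)) auto
      moreover have "(\<Sum>j\<in>I. \<phi> j ((t(i := u)) j)) = (\<Sum>j\<in>I. \<phi> j (t j))"
        using insert.hyps by (intro sum.cong) auto
      ultimately show ?thesis using insert.hyps by simp
    qed
  qed (use insert.prems in auto)
  have ne: "T i \<noteq> {}" using insert.prems by simp
  have le: "\<phi> i u \<le> W - (\<Sum>j\<in>I. Sup (\<phi> j ` T j))" if "u \<in> T i" for u
    using rest[OF that] by simp
  then have "bdd_above (\<phi> i ` T i)" by (intro bdd_aboveI) auto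
  moreover have "Sup (\<phi> i ` T i) \<le> W - (\<Sum>j\<in>I. Sup (\<phi> j ` T j))"
    using ne le by (intro cSup_least) auto
  ultimately show ?case using rest ne insert.hyps by auto
qed

text \<open>Separability turns the bound on joint displacements of all samples into numbers \<open>s i k\<close>, one per
  sample and coordinate, because the norm is a sum over coordinates as well.\<close>

lemma dual_certificate_exists:
  fixes \<Xi> :: "(real ^ 'k) set"
  assumes N: "N \<ge> 1" and J: "J \<ge> 1" and lam: "lam \<ge> 0"
    and \<Xi>: "\<Xi> = {\<xi>. \<forall>k. \<xi> $ k \<in> polyhedron1 (m k) (C k) (d k)}"
    and h: "\<forall>i\<in>{1..N}. \<xi>h i \<in> \<Xi>"
    and W: "\<And>y. (\<forall>i\<in>{1..N}. y i \<in> \<Xi>) \<Longrightarrow>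
      1 / real N * (\<Sum>i=1..N. separable_max J a b (y i) - lam * l1_norm (y i - \<xi>h i)) \<le> W"
  shows "\<exists>s \<gamma>. dual_certificate N J \<xi>h a b m C d lam s \<gamma> \<and>
    1 / real N * (\<Sum>i=1..N. \<Sum>k\<in>UNIV. s i k) \<le> W"
proof -
  define T where "T k = polyhedron1 (m k) (C k) (d k)" for k
  define M where "M k t = Max ((\<lambda>j. a j k * t + b j k) ` {1..J})" for k t
  define \<phi> where "\<phi> = (\<lambda>(i, k) t. M k t - lam * \<bar>t - \<xi>h i $ k\<bar>)"
  define s where "s i k = Sup (\<phi> (i, k) ` T k)" for i k
  let ?I = "{1..N} \<times> (UNIV :: 'k set)"
  have hT: "\<xi>h i $ k \<in> T k" if "i \<in> {1..N}" for i k using bspec[OF h that] by (simp add: \<Xi> T_def)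
  have *: "(\<forall>p\<in>?I. bdd_above (\<phi> p ` T (snd p))) \<and> (\<Sum>p\<in>?I. Sup (\<phi> p ` T (snd p))) \<le> real N * W"
  proof (rule sum_Sup_le)
    fix t assume t: "\<forall>p\<in>?I. t p \<in> T (snd p)"
    define y where "y i = (\<chi> k. t (i, k))" for i
    have "1 / real N * (\<Sum>i=1..N. separable_max J a b (y i) - lam * l1_norm (y i - \<xi>h i)) \<le> W"
      using t by (intro W) (auto simp: y_def \<Xi> T_def)
    also have "(\<Sum>i=1..N. separable_max J a b (y i) - lam * l1_norm (y i - \<xi>h i)) = (\<Sum>p\<in>?I. \<phi> p (t p))"
      by (simp add: \<phi>_def y_def separable_max_def l1_norm_vec M_def
          sum_subtractf sum_distrib_left sum.cartesian_product case_prod_unfold)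
    finally show "(\<Sum>p\<in>?I. \<phi> p (t p)) \<le> real N * W" using N by (simp add: field_simps)
  qed (use hT[of 1] N in auto)
  have piece: "a j k * t + b j k - lam * \<bar>t - \<xi>h i $ k\<bar> \<le> s i k"
    if "i \<in> {1..N}" "j \<in> {1..J}" "t \<in> T k" for i j k t
  proof -
    have "a j k * t + b j k \<le> M k t" unfolding M_def using that by (intro Max_ge) auto
    moreover have "\<phi> (i, k) t \<le> s i k"
      unfolding s_def using * that by (intro cSup_upper) force+
    ultimately show ?thesis by (simp add: \<phi>_def)
  qed
  define ok where "ok i j k g \<longleftrightarrow>
      (\<forall>r\<in>{1..m k}. 0 \<le> g r) \<and> \<bar>(\<Sum>r=1..m k. C k r * g r) - a j k\<bar> \<le> lam \<and>
      b j k + a j k * \<xi>h i $ k + (\<Sum>r=1..m k. g r * (d k r - C k r * \<xi>h i $ k)) \<le> s i k" for i j k g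
  have ex: "\<exists>g. ok i j k g" if "i \<in> {1..N}" "j \<in> {1..J}" for i j k
    using hT[OF that(1)] piece[OF that] lam unfolding T_def ok_def
    by (intro polyhedron1_multiplier) auto
  have "ok i j k (SOME g. ok i j k g)" if "i \<in> {1..N}" "j \<in> {1..J}" for i j k
    by (rule someI_ex[OF ex[OF that]])
  then have "dual_certificate N J \<xi>h a b m C d lam s (\<lambda>i j k. SOME g. ok i j k g)"
    unfolding dual_certificate_def using ok_def by blast
  moreover have "(\<Sum>i=1..N. \<Sum>k\<in>UNIV. s i k) \<le> real N * W"
    using * by (simp add: sum.cartesian_product s_def case_prod_unfold)
  then have "1 / real N * (\<Sum>i=1..N. \<Sum>k\<in>UNIV. s i k) \<le> W" using N by (simp add: field_simps)
  ultimately show ?thesis by blast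
qed

section \<open>The worst case as a minimum over certificates\<close>

lemma worst_case_le_dual_certificate:
  fixes \<Xi> :: "(real ^ 'k) set"
  assumes N: "N \<ge> 1" and J: "J \<ge> 1" and eps: "\<epsilon> \<ge> 0"
    and \<Xi>: "\<Xi> = {\<xi>. \<forall>k. \<xi> $ k \<in> polyhedron1 (m k) (C k) (d k)}" and \<Xi>m: "\<Xi> \<in> sets borel"
    and cert: "dual_certificate N J \<xi>h a b m C d lam s \<gamma>"
    and P: "P \<in> wasserstein_ball \<Xi> (empirical N \<xi>h) \<epsilon>"
  shows "(LINT \<xi>:\<Xi>|P. separable_max J a b \<xi>) \<le>
    lam * \<epsilon> + 1 / real N * (\<Sum>i=1..N. \<Sum>k\<in>UNIV. s i k)"
proof (rule wasserstein_weak_duality[OF N eps dual_certificate_nonneg[OF N J cert] \<Xi>m P])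
  have "P \<in> prob_dists \<Xi>" using P by (simp add: wasserstein_ball_def)
  moreover from this have "\<Xi> \<in> sets P" using \<Xi>m by (simp add: prob_dists_def)
  ultimately show "set_integrable P \<Xi> (separable_max J a b)"
    unfolding set_integrable_def by (intro integrable_mult_indicator integrable_separable_max J)
  show "separable_max J a b \<xi> \<le> lam * l1_norm (\<xi> - \<xi>h i) + (\<Sum>k\<in>UNIV. s i k)"
    if "i \<in> {1..N}" "\<xi> \<in> \<Xi>" for i \<xi>
    using that by (intro dual_certificate_bound[OF J cert]) (auto simp: \<Xi>)
qed

text \<open>A Lipschitz constant \<open>L\<close> of the loss gives a first certificate, whose \<open>s\<close>-part is at most the empirical
  loss. It bounds the worst case from above, which makes the separation argument available for
  \<open>\<epsilon> > 0\<close>, and it is already optimal for \<open>\<epsilon> = 0\<close>, since the empirical distribution belongs to every ball.\<close>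

lemma worst_case_dual_attained:
  fixes \<Xi> :: "(real ^ 'k) set"
  assumes N: "N \<ge> 1" and J: "J \<ge> 1" and eps: "\<epsilon> \<ge> 0"
    and \<Xi>: "\<Xi> = {\<xi>. \<forall>k. \<xi> $ k \<in> polyhedron1 (m k) (C k) (d k)}" and \<Xi>m[measurable]: "\<Xi> \<in> sets borel"
    and h: "\<forall>i\<in>{1..N}. \<xi>h i \<in> \<Xi>"
  shows "\<exists>lam s \<gamma>. dual_certificate N J \<xi>h a b m C d lam s \<gamma> \<and>
    ereal (lam * \<epsilon> + 1 / real N * (\<Sum>i=1..N. \<Sum>k\<in>UNIV. s i k)) \<le>
    (SUP P\<in>wasserstein_ball \<Xi> (empirical N \<xi>h) \<epsilon>. ereal (LINT \<xi>:\<Xi>|P. separable_max J a b \<xi>))"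
proof -
  let ?f = "separable_max J a b"
  let ?ball = "wasserstein_ball \<Xi> (empirical N \<xi>h) \<epsilon>"
  let ?W = "SUP P\<in>?ball. ereal (LINT \<xi>:\<Xi>|P. ?f \<xi>)"
  let ?emp = "1 / real N * (\<Sum>i=1..N. ?f (\<xi>h i))"
  have fm: "(\<lambda>\<xi>. indicator \<Xi> \<xi> * ?f \<xi>) \<in> borel_measurable borel" by measurable
  define L where "L = (\<Sum>j=1..J. \<Sum>k\<in>UNIV. \<bar>a j k\<bar>)"
  have L: "\<bar>a j k\<bar> \<le> L" if "j \<in> {1..J}" for j k
  proof -
    have "\<bar>a j k\<bar> \<le> (\<Sum>k\<in>UNIV. \<bar>a j k\<bar>)" by (rule member_le_sum) auto
    also have "\<dots> \<le> L"
      unfolding L_def using that by (rule member_le_sum) (auto intro: sum_nonneg)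
    finally show ?thesis .
  qed
  have "\<exists>s \<gamma>. dual_certificate N J \<xi>h a b m C d L s \<gamma> \<and> 1 / real N * (\<Sum>i=1..N. \<Sum>k\<in>UNIV. s i k) \<le> ?emp"
  proof (rule dual_certificate_exists[OF N J _ \<Xi> h])
    show "0 \<le> L" by (simp add: L_def sum_nonneg)
    show "1 / real N * (\<Sum>i=1..N. ?f (y i) - L * l1_norm (y i - \<xi>h i)) \<le> ?emp" for y
      using separable_max_lipschitz[OF J, of a L b] L
      by (intro mult_left_mono sum_mono) (auto simp: diff_le_eq)
  qed
  then obtain s0 \<gamma>0 where c0: "dual_certificate N J \<xi>h a b m C d L s0 \<gamma>0"
    and s0: "1 / real N * (\<Sum>i=1..N. \<Sum>k\<in>UNIV. s0 i k) \<le> ?emp" by blast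
  have emp: "ereal ?emp \<le> ?W"
  proof -
    define q where "q = map_pmf (\<lambda>i. (\<xi>h i, i)) (pmf_of_set {1..N})"
    note q = finite_couplings_transport[OF N h, folded q_def]
    have "measure_pmf.expectation q (\<lambda>(y, i). l1_norm (y - \<xi>h i)) \<le> \<epsilon>"
      using eps by (simp add: q(2) l1_norm_vec)
    from finite_couplings_ball[OF N \<Xi>m fm q(1) this] obtain P where P: "P \<in> ?ball"
      and "(LINT \<xi>:\<Xi>|P. ?f \<xi>) = measure_pmf.expectation q (\<lambda>(y, i). ?f y)" by blast
    then have "(LINT \<xi>:\<Xi>|P. ?f \<xi>) = ?emp" by (simp add: q(2))
    with SUP_upper[OF P, of "\<lambda>P. ereal (LINT \<xi>:\<Xi>|P. ?f \<xi>)"] show ?thesis by simp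
  qed
  moreover have "?W \<le> ereal (L * \<epsilon> + 1 / real N * (\<Sum>i=1..N. \<Sum>k\<in>UNIV. s0 i k))"
    using worst_case_le_dual_certificate[OF N J eps \<Xi> \<Xi>m c0] by (intro SUP_least) simp
  ultimately have "\<exists>V. w = ereal V" if "w = ?W" for w unfolding that[symmetric] by (cases w) auto
  then obtain V where V: "?W = ereal V" by blast
  show ?thesis
  proof (cases "\<epsilon> = 0")
    case True
    with s0 have "ereal (L * \<epsilon> + 1 / real N * (\<Sum>i=1..N. \<Sum>k\<in>UNIV. s0 i k)) \<le> ereal ?emp" by simp
    from c0 order_trans[OF this emp] show ?thesis by blast
  next
    case False
    then have "\<epsilon> > 0" using eps by simp
    have "(LINT \<xi>:\<Xi>|P. ?f \<xi>) \<le> V" if "P \<in> ?ball" for P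
      using SUP_upper[OF that, of "\<lambda>P. ereal (LINT \<xi>:\<Xi>|P. ?f \<xi>)"] V by simp
    from wasserstein_multiplier_exists[OF N \<open>\<epsilon> > 0\<close> \<Xi>m h fm this] obtain lam where "lam \<ge> 0"
      and "\<And>y. (\<forall>i\<in>{1..N}. y i \<in> \<Xi>) \<Longrightarrow>
        1 / real N * (\<Sum>i=1..N. ?f (y i) - lam * l1_norm (y i - \<xi>h i)) \<le> V - lam * \<epsilon>" by blast
    from dual_certificate_exists[OF N J this(1) \<Xi> h this(2)] obtain s \<gamma>
      where "dual_certificate N J \<xi>h a b m C d lam s \<gamma>"
        and "1 / real N * (\<Sum>i=1..N. \<Sum>k\<in>UNIV. s i k) \<le> V - lam * \<epsilon>" by blast
    then show ?thesis unfolding V by (intro exI[of _ lam] exI[of _ s] exI[of _ \<gamma>]) auto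
  qed
qed

text \<open>Attainment in every fibre is what makes minimizers correspond; equality of the infima alone would not
  lift a minimizer of \<open>W\<close> to one of \<open>g\<close>.\<close>

lemma INF_and_minimizers_by_fibres:
  fixes W :: "'a \<Rightarrow> ereal" and F :: "('a \<times> 'b) set" and g :: "'a \<times> 'b \<Rightarrow> ereal"
  assumes weak: "\<And>x z. (x, z) \<in> F \<Longrightarrow> x \<in> X \<and> W x \<le> g (x, z)"
    and attained: "\<And>x. x \<in> X \<Longrightarrow> \<exists>z. (x, z) \<in> F \<and> g (x, z) \<le> W x"
  shows "(INF x\<in>X. W x) = (INF p\<in>F. g p)"
    and "is_minimizer W X x \<longleftrightarrow> (\<exists>z. is_minimizer g F (x, z))"
proof -
  show "(INF x\<in>X. W x) = (INF p\<in>F. g p)"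
  proof (rule antisym)
    show "(INF x\<in>X. W x) \<le> (INF p\<in>F. g p)"
      using weak by (intro INF_mono) (metis surj_pair)
    show "(INF p\<in>F. g p) \<le> (INF x\<in>X. W x)"
      using attained by (intro INF_mono) blast
  qed
  show "is_minimizer W X x \<longleftrightarrow> (\<exists>z. is_minimizer g F (x, z))"
  proof
    assume x: "is_minimizer W X x"
    with attained obtain z where z: "(x, z) \<in> F" "g (x, z) \<le> W x" by (auto simp: is_minimizer_def)
    have "g (x, z) \<le> g (y, w)" if "(y, w) \<in> F" for y w
      using weak[OF that] x z(2) by (auto simp: is_minimizer_def intro: order_trans)
    with z show "\<exists>z. is_minimizer g F (x, z)" by (auto simp: is_minimizer_def)
  next
    assume "\<exists>z. is_minimizer g F (x, z)"
    then obtain z where z: "(x, z) \<in> F" "\<And>p. p \<in> F \<Longrightarrow> g (x, z) \<le> g p"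
      by (auto simp: is_minimizer_def)
    have "W x \<le> W y" if "y \<in> X" for y
    proof -
      from attained[OF that] obtain w where "(y, w) \<in> F" "g (y, w) \<le> W y" by blast
      with z weak[OF z(1)] show ?thesis by (meson order_trans)
    qed
    with weak[OF z(1)] show "is_minimizer W X x" by (simp add: is_minimizer_def)
  qed
qed

section \<open>The reformulation\<close>

text \<open>On the support each \<open>l x j k\<close> is the given affine function, so the loss agrees there with
  \<open>separable_max\<close>, and the samples lie in the support because each carries positive empirical mass.\<close>

theorem theorem1:
  fixes loss :: "(real ^ 'k) \<Rightarrow> (real ^ 'k) \<Rightarrow> real"
    and l :: "(real ^ 'k) \<Rightarrow> nat \<Rightarrow> 'k \<Rightarrow> real \<Rightarrow> ereal"
    and a b :: "(real ^ 'k) \<Rightarrow> nat \<Rightarrow> 'k \<Rightarrow> real"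
    and \<Xi> :: "(real ^ 'k) set" and \<Xi>c :: "'k \<Rightarrow> real set"
    and m :: "'k \<Rightarrow> nat" and C d :: "'k \<Rightarrow> nat \<Rightarrow> real"
    and \<xi>h :: "nat \<Rightarrow> real ^ 'k"
    and N J :: nat and B \<epsilon> :: real
  assumes "B > 0" and "\<epsilon> \<ge> 0" and "N \<ge> 1" and "J \<ge> 1"
    and "\<Xi> = {\<xi>. \<forall>k. \<xi> $ k \<in> \<Xi>c k}"
    and "\<And>k. closed (\<Xi>c k)" and "\<And>k. convex (\<Xi>c k)"
    and "closed \<Xi>" and "convex \<Xi>"
    and "\<And>k. \<Xi>c k = polyhedron1 (m k) (C k) (d k)"
    and "empirical N \<xi>h \<in> prob_dists \<Xi>"
    and "\<And>x \<xi>. x \<in> budget_set B \<Longrightarrow> \<xi> \<in> \<Xi> \<Longrightarrow>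
           ereal (loss x \<xi>) = (\<Sum>k\<in>UNIV. Max ((\<lambda>j. l x j k (\<xi> $ k)) ` {1..J}))"
    and "\<And>x j k. x \<in> budget_set B \<Longrightarrow> j \<in> {1..J} \<Longrightarrow>
           l x j k \<in> borel_measurable borel \<and>
           proper_fun (\<lambda>t. - l x j k t) \<and> convex_fun (\<lambda>t. - l x j k t) \<and> lsc_fun (\<lambda>t. - l x j k t)"
    and "\<And>x j k t. x \<in> budget_set B \<Longrightarrow> j \<in> {1..J} \<Longrightarrow> t \<in> \<Xi>c k \<Longrightarrow>
           l x j k t = ereal (a x j k * t + b x j k)"
  shows "(INF x\<in>budget_set B. worst_case loss \<Xi> (wasserstein_ball \<Xi> (empirical N \<xi>h) \<epsilon>) x)
         = (INF z\<in>dual_feasible (budget_set B) N J \<xi>h a b m C d. ereal (dual_objective \<epsilon> N z))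
       \<and> (\<forall>x. is_minimizer (worst_case loss \<Xi> (wasserstein_ball \<Xi> (empirical N \<xi>h) \<epsilon>)) (budget_set B) x
          \<longleftrightarrow> (\<exists>lam s \<gamma>. is_minimizer (\<lambda>z. ereal (dual_objective \<epsilon> N z))
                 (dual_feasible (budget_set B) N J \<xi>h a b m C d) (x, lam, s, \<gamma>)))"
  proof -
  note N = assms(3) and J = assms(4) and eps = assms(2)
  let ?ball = "wasserstein_ball \<Xi> (empirical N \<xi>h) \<epsilon>"
  let ?W = "worst_case loss \<Xi> ?ball"
  let ?F = "dual_feasible (budget_set B) N J \<xi>h a b m C d"
  let ?g = "\<lambda>z. ereal (dual_objective \<epsilon> N z)"
  have \<Xi>: "\<Xi> = {\<xi>. \<forall>k. \<xi> $ k \<in> polyhedron1 (m k) (C k) (d k)}" using assms(5,10) by simp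
  have \<Xi>m: "\<Xi> \<in> sets borel" using assms(8) by (rule borel_closed)
  have h: "\<forall>i\<in>{1..N}. \<xi>h i \<in> \<Xi>"
  proof -
    have "AE \<xi> in empirical N \<xi>h. \<xi> \<in> \<Xi>" using assms(11) by (simp add: prob_dists_def)
    with AE_empirical_iff[OF N, of "\<lambda>\<xi>. \<xi> \<in> \<Xi>"] \<Xi>m show ?thesis by simp
  qed
  have loss: "loss x \<xi> = separable_max J (a x) (b x) \<xi>" if "x \<in> budget_set B" "\<xi> \<in> \<Xi>" for x \<xi>
  proof -
    have "Max ((\<lambda>j. l x j k (\<xi> $ k)) ` {1..J}) = ereal (Max ((\<lambda>j. a x j k * \<xi> $ k + b x j k) ` {1..J}))" for k
    proof -
      have "\<xi> $ k \<in> \<Xi>c k" using that(2) assms(5) by simp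
      then have "(\<lambda>j. l x j k (\<xi> $ k)) ` {1..J} = ereal ` (\<lambda>j. a x j k * \<xi> $ k + b x j k) ` {1..J}"
        unfolding image_image using assms(14)[OF that(1)] by (intro image_cong) auto
      then show ?thesis using J by (simp add: mono_Max_commute[of ereal] mono_def)
    qed
    then show ?thesis using assms(12)[OF that] by (simp add: separable_max_def)
  qed
  have W: "?W x = (SUP P\<in>?ball. ereal (LINT \<xi>:\<Xi>|P. separable_max J (a x) (b x) \<xi>))"
    if "x \<in> budget_set B" for x
  proof -
    have "(\<lambda>\<xi>. indicator \<Xi> \<xi> *\<^sub>R loss x \<xi>) = (\<lambda>\<xi>. indicator \<Xi> \<xi> *\<^sub>R separable_max J (a x) (b x) \<xi>)"
      using loss[OF that] by (auto simp: indicator_def)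
    then show ?thesis by (simp add: worst_case_def set_lebesgue_integral_def)
  qed
  have weak: "x \<in> budget_set B \<and> ?W x \<le> ?g (x, z)" if F: "(x, z) \<in> ?F" for x z
  proof -
    obtain lam s \<gamma> where z: "z = (lam, s, \<gamma>)" by (cases z)
    from F have x: "x \<in> budget_set B" and cert: "dual_certificate N J \<xi>h (a x) (b x) m C d lam s \<gamma>"
      by (auto simp: z dual_feasible_iff)
    have "?W x \<le> ?g (x, z)"
      unfolding W[OF x] z using worst_case_le_dual_certificate[OF N J eps \<Xi> \<Xi>m cert]
      by (intro SUP_least) (simp add: dual_objective_def)
    with x show ?thesis by simp
  qed
  have attained: "\<exists>z. (x, z) \<in> ?F \<and> ?g (x, z) \<le> ?W x" if x: "x \<in> budget_set B" for x
  proof -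
    from worst_case_dual_attained[OF N J eps \<Xi> \<Xi>m h, where a = "a x" and b = "b x"] obtain lam s \<gamma>
      where "dual_certificate N J \<xi>h (a x) (b x) m C d lam s \<gamma>"
        "ereal (lam * \<epsilon> + 1 / real N * (\<Sum>i=1..N. \<Sum>k\<in>UNIV. s i k)) \<le> ?W x"
      unfolding W[OF x] by blast
    with x show ?thesis
      by (intro exI[of _ "(lam, s, \<gamma>)"]) (simp add: dual_feasible_iff dual_objective_def)
  qed
  note fibres = INF_and_minimizers_by_fibres[of ?F "budget_set B" ?W ?g, OF weak attained]
  have "is_minimizer ?W (budget_set B) x \<longleftrightarrow> (\<exists>lam s \<gamma>. is_minimizer ?g ?F (x, lam, s, \<gamma>))" for x
    using fibres(2)[of x] by (simp only: split_paired_Ex)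
  then show ?thesis by (intro conjI allI fibres(1))
qed

end
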